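(* Under the standing assumptions (a1), (a2) of the context: to minimize the suboptimality bound $K=\frac12\sum_{n=1}^Nw_n\max\{\overline b_n^2,\underline b_n^2\}$ and guarantee feasibility of the state-of-charge variables ($\underline{\mathbf s}\le\hat{\mathbf s}^t\le\overline{\mathbf s}$ for all $t$, through the parameter conditions (P) of the context), the parameters $\{\boldsymbol\gamma,\mathbf w\}$ in the real-time problem should be selected, for all $n\in\{1,\dots,N\}$, as $$w_n^\star:=\delta_n^{-1},\qquad \gamma_n^\star:=-\frac{\overline g_n(\overline s_n-\overline b_n)-\underline g_n(\underline s_n-\underline b_n)}{\overline g_n-\underline g_n}>0 .$$ The suboptimality bound becomes $$K^\star:=\sum_{n=1}^N\frac{\max\{\overline b_n^2,\underline b_n^2\}}{2\delta_n}.$$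
   Context: Setting. There are $N$ users (one per bus of a radial distribution grid), indexed by $n$, and time periods $t=0,1,2,\dots$. Vector inequalities are entrywise, and $\mathbf 1$ is the all-one vector. At time $t$: $\boldsymbol\ell^t,\mathbf q^t\in\mathbb R^N$ are the active and reactive loads, bounded within known intervals $\underline{\boldsymbol\ell}\le\boldsymbol\ell^t\le\overline{\boldsymbol\ell}$ and $\underline{\mathbf q}\le\mathbf q^t\le\overline{\mathbf q}$; $r^t\in\{-1,+1\}$ is the regulation signal; the prices satisfy $0\le\underline c_0\le c_0^t\le\overline c_0$, $0\le\underline c_p\le c_p^t\le\overline c_p$ and $0\le\underline c_r\le c_r^t\le\overline c_r$. The decisions are the battery charges $\mathbf b^t\in\mathbb R^N$ (positive when charging, negative when discharging), with limits $\underline{\mathbf b}\le\mathbf 0\le\overline{\mathbf b}$; $\mathbf s^t$ is the vector of states of charge, with limits $\underline{\mathbf s},\overline{\mathbf s}$ and initial value $\mathbf s^0\in[\underline{\mathbf s},\overline{\mathbf s}]$. The net demand is $\mathbf p^t=\boldsymbol\ell^t+\mathbf b^t$, and the per-unit energy price $c_0^t+c_p^t\sum_{i=1}^Np_i^t$ is assumed positive for all $t$. The matrices are $\mathbf R=2(\mathbf A^\top \mathrm{diag}(\rho)^{-1}\mathbf A)^{-1}$ and $\mathbf X=2(\mathbf A^\top \mathrm{diag}(\chi)^{-1}\mathbf A)^{-1}$, where $\mathbf A$ is the (square, invertible) reduced branch-bus incidence matrix of the radial grid and $\rho,\chi$ are the vectors of line resistances and reactances; $\mathbf R,\mathbf X$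 have nonnegative entries. The scalars $\alpha,\beta$ are fixed voltage regulation limits. Constraints, for all $t$: (i) $\mathbf s^{t+1}=\mathbf s^t+\mathbf b^t$ and $\underline{\mathbf s}\le\mathbf s^t\le\overline{\mathbf s}$; (ii) $\underline{\mathbf b}\le\mathbf b^t\le\overline{\mathbf b}$; (iii) $\mathbf p^t=\boldsymbol\ell^t+\mathbf b^t$; (iv) $\alpha\mathbf 1\le-\mathbf R\mathbf p^t-\mathbf X\mathbf q^t\le\beta\mathbf 1$; (v) $r^t=\mathrm{sign}(b_n^t)$ for all $n$, understood as: batteries can only be charged ($b_n^t\ge0$) when $r^t=+1$ and only be discharged ($b_n^t\le0$) when $r^t=-1$, with $b_n^t=0$ allowed in both cases. The aggregate cost at time $t$ is $$f^t(\mathbf b^t)=\frac{c_p^t}{2}\Big(\sum_{n=1}^Np_n^t\Big)^2+\sum_{n=1}^N\Big[c_0^tp_n^t+\frac{c_p^t(p_n^t)^2}{2}-r^tc_r^tb_n^t\Big].$$ Real-time problem: given parameters $\gamma_n$, positive weights $w_n$ and the virtual queues $x_n^t:=s_n^t+\gamma_n$, where $s_n^t=\hat s_n^t$ is the current state of charge under the real-time decisions ($\hat{\mathbf s}^0=\mathbf s^0$, $\hat{\mathbf s}^{t+1}=\hat{\mathbf s}^t+\hat{\mathbf b}^t$), the real-time decision $\hat{\mathbf b}^t$ is the minimizer of $\sum_{n=1}^Nw_nx_n^tb_n^t+f^t(\mathbf b^t)$ over $\mathbf b^t$ subject to (ii)–(v) only. The suboptimality bound $K$ is the bound (for random data independent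 and identically distributed over time) on the gap between $\lim_{T\to\infty}\frac1T\sum_{t=0}^{T-1}\mathbb E[f^t(\hat{\mathbf b}^t)]$ and the minimum of $\lim_{T\to\infty}\frac1T\sum_{t=0}^{T-1}\mathbb E[f^t(\mathbf b^t)]$ over sequences satisfying (i)–(v). Constants: $\underline g_n:=\underline c_0+\frac{\underline c_p}{N}\underline{\boldsymbol\ell}^\top\mathbf 1+\frac{\underline c_p}{N}\underline\ell_n-\overline c_r$, $\overline g_n:=\overline c_0+\frac{\overline c_p}{N}\overline{\boldsymbol\ell}^\top\mathbf 1+\frac{\overline c_p}{N}\overline\ell_n+\overline c_r$, and $\delta_n:=(\overline s_n-\underline s_n+\underline b_n-\overline b_n)/(\overline g_n-\underline g_n)>0$. Assumptions: (a1) $\overline s_n-\underline s_n>\overline b_n-\underline b_n$ for all $n$. (a2) $\alpha\mathbf 1\le-\mathbf R\boldsymbol\ell^t-\mathbf X\mathbf q^t\le\beta\mathbf 1$ for all $t$. Parameter conditions (P), which guarantee the feasibility of the states of charge: for all $n$, $w_n\delta_n\ge1$ and $-\frac{\underline g_n}{w_n}+\overline b_n-\overline s_n\le\gamma_n\le-\frac{\overline g_n}{w_n}+\underline b_n-\underline s_n$.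
   Formalization: The claim γ*>0 is false in general and is replaced by the exact condition for it; feasibility of the states of charge does not follow from (P) when N≥2 and is stated assuming the constants g̲_n, ḡ_n bracket the marginal costs at b=0. *)

theory Defs
  imports "HOL-Probability.Probability"
begin

text \<open>
  Users, non-substation buses and lines are all indexed by the finite type \<open>'n\<close>, so that
  \<open>N = CARD('n)\<close>. Inequalities between vectors are the entrywise order on \<open>real ^ 'n\<close>.
\<close>

text \<open>Line endpoints are \<open>Some n\<close> for the bus \<open>n\<close> and \<open>None\<close> for the substation.\<close>

record 'n grid_params =
  line_from :: "'n \<Rightarrow> 'n option"
  line_to :: "'n \<Rightarrow> 'n option"
  resistance :: "real ^ 'n"
  reactance :: "real ^ 'n"
  volt_lo :: real
  volt_hi :: real
  load_lo :: "real ^ 'n"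
  load_hi :: "real ^ 'n"
  rload_lo :: "real ^ 'n"
  rload_hi :: "real ^ 'n"
  b_lo :: "real ^ 'n"
  b_hi :: "real ^ 'n"
  s_lo :: "real ^ 'n"
  s_hi :: "real ^ 'n"
  s_init :: "real ^ 'n"
  c0_lo :: real
  c0_hi :: real
  cp_lo :: real
  cp_hi :: real
  cr_lo :: real
  cr_hi :: real

text \<open>
  The data of one period: active loads, reactive loads, regulation signal, and the prices
  \<open>c\<^sub>0\<close>, \<open>c\<^sub>p\<close>, \<open>c\<^sub>r\<close>. A tuple is used so that the data carry the product Borel structure.
\<close>

type_synonym 'n datum = "(real ^ 'n) \<times> (real ^ 'n) \<times> real \<times> real \<times> real \<times> real"

definition load :: "'n datum \<Rightarrow> real ^ 'n" where
  "load = (\<lambda>(l, q, r, c0, cp, cr). l)"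

definition rload :: "'n datum \<Rightarrow> real ^ 'n" where
  "rload = (\<lambda>(l, q, r, c0, cp, cr). q)"

definition regsig :: "'n datum \<Rightarrow> real" where
  "regsig = (\<lambda>(l, q, r, c0, cp, cr). r)"

definition price0 :: "'n datum \<Rightarrow> real" where
  "price0 = (\<lambda>(l, q, r, c0, cp, cr). c0)"

definition pricep :: "'n datum \<Rightarrow> real" where
  "pricep = (\<lambda>(l, q, r, c0, cp, cr). cp)"

definition pricer :: "'n datum \<Rightarrow> real" where
  "pricer = (\<lambda>(l, q, r, c0, cp, cr). cr)"

definition diag_mat :: "real ^ 'n \<Rightarrow> real ^ 'n ^ 'n" where
  "diag_mat v = (\<chi> i j. if i = j then v $ i else 0)"

text \<open>
  Rows are lines, columns are buses, and the substation column is removed. With as many lines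
  as non-substation buses, this matrix is invertible exactly when the grid is a tree.
\<close>

definition incidence :: "'n grid_params \<Rightarrow> real ^ 'n ^ 'n" where
  "incidence G = (\<chi> l n. (if line_from G l = Some n then 1 else 0)
                         - (if line_to G l = Some n then 1 else 0))"

definition R_mat :: "('n::finite) grid_params \<Rightarrow> real ^ 'n ^ 'n" where
  "R_mat G = 2 *\<^sub>R matrix_inv
     (transpose (incidence G) ** matrix_inv (diag_mat (resistance G)) ** incidence G)"

definition X_mat :: "('n::finite) grid_params \<Rightarrow> real ^ 'n ^ 'n" where
  "X_mat G = 2 *\<^sub>R matrix_inv
     (transpose (incidence G) ** matrix_inv (diag_mat (reactance G)) ** incidence G)"

definition well_posed :: "('n::finite) grid_params \<Rightarrow> bool" where
  "well_posed G \<longleftrightarrow>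
     invertible (incidence G) \<and>
     (\<forall>l. 0 < resistance G $ l \<and> 0 < reactance G $ l) \<and>
     (\<forall>i j. 0 \<le> R_mat G $ i $ j \<and> 0 \<le> X_mat G $ i $ j) \<and>
     b_lo G \<le> 0 \<and> 0 \<le> b_hi G \<and>
     s_lo G \<le> s_init G \<and> s_init G \<le> s_hi G \<and>
     0 \<le> c0_lo G \<and> 0 \<le> cp_lo G \<and> 0 \<le> cr_lo G"

definition voltage_ok :: "('n::finite) grid_params \<Rightarrow> 'n datum \<Rightarrow> real ^ 'n \<Rightarrow> bool" where
  "voltage_ok G d p \<longleftrightarrow>
     vec (volt_lo G) \<le> - (R_mat G *v p) - X_mat G *v rload d \<and>
     - (R_mat G *v p) - X_mat G *v rload d \<le> vec (volt_hi G)"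

text \<open>The constraints of a single period, that is, all constraints but those on the states of charge.\<close>

definition operational :: "('n::finite) grid_params \<Rightarrow> 'n datum \<Rightarrow> real ^ 'n \<Rightarrow> bool" where
  "operational G d b \<longleftrightarrow>
     b_lo G \<le> b \<and> b \<le> b_hi G \<and>
     voltage_ok G d (load d + b) \<and>
     (regsig d = 1 \<longrightarrow> 0 \<le> b) \<and> (regsig d = - 1 \<longrightarrow> b \<le> 0)"

definition data_ok :: "('n::finite) grid_params \<Rightarrow> 'n datum \<Rightarrow> bool" where
  "data_ok G d \<longleftrightarrow>
     load_lo G \<le> load d \<and> load d \<le> load_hi G \<and>
     rload_lo G \<le> rload d \<and> rload d \<le> rload_hi G \<and>
     regsig d \<in> {- 1, 1} \<and>
     c0_lo G \<le> price0 d \<and> price0 d \<le> c0_hi G \<and>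
     cp_lo G \<le> pricep d \<and> pricep d \<le> cp_hi G \<and>
     cr_lo G \<le> pricer d \<and> pricer d \<le> cr_hi G \<and>
     (\<forall>b. operational G d b \<longrightarrow> 0 < price0 d + pricep d * (\<Sum>i\<in>UNIV. (load d + b) $ i))"

definition cost :: "('n::finite) datum \<Rightarrow> real ^ 'n \<Rightarrow> real" where
  "cost d b = (let p = load d + b in
     pricep d / 2 * (\<Sum>n\<in>UNIV. p $ n)\<^sup>2
     + (\<Sum>n\<in>UNIV. price0 d * p $ n + pricep d * (p $ n)\<^sup>2 / 2 - regsig d * pricer d * b $ n))"

primrec soc :: "real ^ 'n \<Rightarrow> (nat \<Rightarrow> real ^ 'n) \<Rightarrow> nat \<Rightarrow> real ^ 'n" where
  "soc s b 0 = s"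
| "soc s b (Suc t) = soc s b t + b t"

definition soc_feasible :: "('n::finite) grid_params \<Rightarrow> (nat \<Rightarrow> real ^ 'n) \<Rightarrow> bool" where
  "soc_feasible G b \<longleftrightarrow>
     (\<forall>t. s_lo G \<le> soc (s_init G) b t \<and> soc (s_init G) b t \<le> s_hi G)"

definition real_time_objective ::
  "real ^ 'n \<Rightarrow> real ^ 'n \<Rightarrow> real ^ 'n \<Rightarrow> ('n::finite) datum \<Rightarrow> real ^ 'n \<Rightarrow> real" where
  "real_time_objective w \<gamma> s d b = (\<Sum>n\<in>UNIV. w $ n * (s $ n + \<gamma> $ n) * b $ n) + cost d b"

definition real_time ::
  "('n::finite) grid_params \<Rightarrow> real ^ 'n \<Rightarrow> real ^ 'n \<Rightarrow> (nat \<Rightarrow> 'n datum) \<Rightarrow> (nat \<Rightarrow> real ^ 'n) \<Rightarrow> bool"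
  where
  "real_time G w \<gamma> \<xi> b \<longleftrightarrow>
     (\<forall>t. is_arg_min (real_time_objective w \<gamma> (soc (s_init G) b t) (\<xi> t)) (operational G (\<xi> t)) (b t))"

text \<open>The decision at time \<open>t\<close> is a measurable function of the data observed up to time \<open>t\<close>.\<close>

definition causal ::
  "'w measure \<Rightarrow> (nat \<Rightarrow> 'w \<Rightarrow> ('n::finite) datum) \<Rightarrow> (nat \<Rightarrow> 'w \<Rightarrow> real ^ 'n) \<Rightarrow> bool" where
  "causal M \<xi> b \<longleftrightarrow>
     (\<forall>t. \<exists>F \<in> borel_measurable (Pi\<^sub>M {..t} (\<lambda>_. borel)).
        \<forall>\<omega>\<in>space M. b t \<omega> = F (\<lambda>i\<in>{..t}. \<xi> i \<omega>))"

definition iid :: "'w measure \<Rightarrow> (nat \<Rightarrow> 'w \<Rightarrow> ('n::finite) datum) \<Rightarrow> bool" where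
  "iid M \<xi> \<longleftrightarrow>
     prob_space.indep_vars M (\<lambda>_. borel) \<xi> UNIV \<and>
     (\<forall>t. distr M borel (\<xi> t) = distr M borel (\<xi> 0))"

definition long_run_cost ::
  "'w measure \<Rightarrow> (nat \<Rightarrow> 'w \<Rightarrow> ('n::finite) datum) \<Rightarrow> (nat \<Rightarrow> 'w \<Rightarrow> real ^ 'n) \<Rightarrow> real \<Rightarrow> bool" where
  "long_run_cost M \<xi> b L \<longleftrightarrow>
     (\<lambda>T. (\<Sum>t<T. \<integral>\<omega>. cost (\<xi> t \<omega>) (b t \<omega>) \<partial>M) / real T) \<longlonglongrightarrow> L"

text \<open>
  The long-run costs attained under all constraints. The competing decisions may be arbitrary
  random variables; they are not required to be causal.
\<close>

definition attainable_costs ::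
  "('n::finite) grid_params \<Rightarrow> 'w measure \<Rightarrow> (nat \<Rightarrow> 'w \<Rightarrow> 'n datum) \<Rightarrow> real set" where
  "attainable_costs G M \<xi> = {v. \<exists>b.
     (\<forall>t. b t \<in> borel_measurable M) \<and>
     (\<forall>\<omega>\<in>space M. (\<forall>t. operational G (\<xi> t \<omega>) (b t \<omega>)) \<and> soc_feasible G (\<lambda>t. b t \<omega>)) \<and>
     long_run_cost M \<xi> b v}"

definition g_lo :: "('n::finite) grid_params \<Rightarrow> 'n \<Rightarrow> real" where
  "g_lo G n = c0_lo G + cp_lo G / real CARD('n) * (\<Sum>i\<in>UNIV. load_lo G $ i)
              + cp_lo G / real CARD('n) * load_lo G $ n - cr_hi G"

definition g_hi :: "('n::finite) grid_params \<Rightarrow> 'n \<Rightarrow> real" where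
  "g_hi G n = c0_hi G + cp_hi G / real CARD('n) * (\<Sum>i\<in>UNIV. load_hi G $ i)
              + cp_hi G / real CARD('n) * load_hi G $ n + cr_hi G"

definition \<delta> :: "('n::finite) grid_params \<Rightarrow> 'n \<Rightarrow> real" where
  "\<delta> G n = (s_hi G $ n - s_lo G $ n + b_lo G $ n - b_hi G $ n) / (g_hi G n - g_lo G n)"

definition params_ok :: "('n::finite) grid_params \<Rightarrow> real ^ 'n \<Rightarrow> real ^ 'n \<Rightarrow> bool" where
  "params_ok G w \<gamma> \<longleftrightarrow> (\<forall>n.
     0 < w $ n \<and> 1 \<le> w $ n * \<delta> G n \<and>
     - g_lo G n / w $ n + b_hi G $ n - s_hi G $ n \<le> \<gamma> $ n \<and>
     \<gamma> $ n \<le> - g_hi G n / w $ n + b_lo G $ n - s_lo G $ n)"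

definition K_bound :: "('n::finite) grid_params \<Rightarrow> real ^ 'n \<Rightarrow> real" where
  "K_bound G w = 1 / 2 * (\<Sum>n\<in>UNIV. w $ n * max ((b_hi G $ n)\<^sup>2) ((b_lo G $ n)\<^sup>2))"

definition w_star :: "('n::finite) grid_params \<Rightarrow> real ^ 'n" where
  "w_star G = (\<chi> n. inverse (\<delta> G n))"

definition \<gamma>_star :: "('n::finite) grid_params \<Rightarrow> real ^ 'n" where
  "\<gamma>_star G = (\<chi> n.
     - ((g_hi G n * (s_hi G $ n - b_hi G $ n) - g_lo G n * (s_lo G $ n - b_lo G $ n))
        / (g_hi G n - g_lo G n)))"

text \<open>
  When the regulation signal is \<open>\<plusminus> 1\<close>, \<open>c\<^sub>0 + c\<^sub>p (\<Sum>\<^sub>i \<ell>\<^sub>i + \<ell>\<^sub>n) \<mp> c\<^sub>r\<close> is the partial derivative of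
  \<^const>\<open>cost\<close> with respect to \<open>b\<^sub>n\<close> at \<open>b = 0\<close>. The definitions of \<^const>\<open>g_lo\<close> and \<^const>\<open>g_hi\<close> divide \<open>c\<^sub>p\<close>
  by \<open>N\<close> although \<^const>\<open>cost\<close> does not, so for \<open>N \<ge> 2\<close> they need not bracket this derivative.
\<close>

definition marginal_cost_within :: "('n::finite) grid_params \<Rightarrow> 'n datum \<Rightarrow> bool" where
  "marginal_cost_within G d \<longleftrightarrow> (\<forall>n.
     g_lo G n \<le> price0 d + pricep d * ((\<Sum>i\<in>UNIV. load d $ i) + load d $ n) - pricer d \<and>
     price0 d + pricep d * ((\<Sum>i\<in>UNIV. load d $ i) + load d $ n) + pricer d \<le> g_hi G n)"

end

theory Submission
  imports Defs
begin

text \<open>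
  The two bounds on \<open>\<gamma>\<^sub>n\<close> in the parameter conditions enclose an interval that is nonempty exactly when
  \<open>w\<^sub>n \<delta>\<^sub>n \<ge> 1\<close> and a single point when \<open>w\<^sub>n \<delta>\<^sub>n = 1\<close>; the bound \<open>K\<close> increases with \<open>w\<close>.

  Feasibility: if \<open>w\<^sub>n x\<^sub>n\<close> exceeds minus the least marginal cost, then resetting a positive charge
  \<open>b\<^sub>n\<close> to 0 stays operational (by (a2) and nonnegativity of \<open>R\<close>) and lowers the objective, so a nearly
  full battery is never charged; symmetrically a nearly empty one is never discharged.

  Suboptimality: the drift of \<open>\<Sum>\<^sub>n w\<^sub>n x\<^sub>n\<^sup>2 / 2\<close> plus the cost is at most \<open>K\<close> plus the real-time objective,
  whose minimum \<open>V(s, d)\<close> is a Borel function of the state of charge and the datum. Since \<open>s\<^sup>t\<close> is independent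
  of \<open>\<xi>\<^sup>t\<close> and the data are identically distributed, \<open>E V(s\<^sup>t, \<xi>\<^sup>t)\<close> can be evaluated with \<open>s\<^sup>t\<close> and \<open>\<xi>\<^sup>\<tau>\<close> on
  independent copies of the probability space, where the decision of any competitor at time \<open>\<tau>\<close> bounds it
  from above. Averaging over \<open>\<tau>\<close> and telescoping over \<open>t\<close> gives the bound.
\<close>

section \<open>Parameter conditions and minimization of the bound \<open>K\<close>\<close>

text \<open>By (a1) the numerator of \<open>\<delta>\<close> is positive, so a positive quotient
  forces a positive denominator.\<close>

lemma g_lo_less_g_hi:
  assumes "b_hi G $ n - b_lo G $ n < s_hi G $ n - s_lo G $ n" and "0 < \<delta> G n"
  shows "g_lo G n < g_hi G n"
  using assms by (auto simp: \<delta>_def zero_less_divide_iff)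

text \<open>With \<open>w $ n\<close> equal to the inverse of \<open>\<delta> G n\<close>, the
  right-hand sides are the lower and upper bounds on \<open>\<gamma> $ n\<close>. They coincide
  because \<open>(g_hi G n - g_lo G n) * \<delta> G n\<close> is the numerator of
  \<open>\<delta>\<close>.\<close>

lemma \<gamma>_star_endpoints:
  assumes "g_lo G n < g_hi G n"
  shows "\<gamma>_star G $ n = - g_lo G n * \<delta> G n + b_hi G $ n - s_hi G $ n"
    and "\<gamma>_star G $ n = - g_hi G n * \<delta> G n + b_lo G $ n - s_lo G $ n"
  using assms by (simp_all add: \<gamma>_star_def \<delta>_def field_simps)

lemma params_ok_star:
  assumes "\<forall>n. g_lo G n < g_hi G n" and "\<forall>n. 0 < \<delta> G n"
  shows "params_ok G (w_star G) (\<gamma>_star G)"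
proof -
  have "1 \<le> w_star G $ n * \<delta> G n" "0 < w_star G $ n" for n
    using assms(2) [rule_format, of n] by (simp_all add: w_star_def)
  moreover have "x / w_star G $ n = x * \<delta> G n" for x n
    by (simp add: w_star_def divide_inverse)
  moreover note \<gamma>_star_endpoints[OF assms(1)[rule_format]]
  ultimately show ?thesis
    unfolding params_ok_def by (metis order_refl)
qed

lemma \<gamma>_unique_if_w_star:
  assumes "g_lo G n < g_hi G n" and "params_ok G w \<gamma>" and "w $ n = w_star G $ n"
  shows "\<gamma> $ n = \<gamma>_star G $ n"
proof -
  have "x / w $ n = x * \<delta> G n" for x
    using assms(3) by (simp add: w_star_def divide_inverse)
  then show ?thesis
    using assms(2) \<gamma>_star_endpoints[OF assms(1)] unfolding params_ok_def by (smt (verit))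
qed

lemma w_star_le:
  assumes "params_ok G w \<gamma>" and "0 < \<delta> G n"
  shows "w_star G $ n \<le> w $ n"
proof -
  have "1 \<le> w $ n * \<delta> G n" using assms(1) by (auto simp: params_ok_def)
  then show ?thesis using assms(2) by (simp add: w_star_def field_simps)
qed

lemma K_bound_mono:
  assumes "\<And>n. v $ n \<le> w $ n"
  shows "K_bound G v \<le> K_bound G w"
  unfolding K_bound_def using assms by (intro mult_left_mono sum_mono mult_right_mono) (auto simp: max_def)

text \<open>A user whose charge limits both vanish contributes 0 to \<open>K\<close> whatever its
  weight; for any other user the coefficient of the weight is positive. Hence minimizing
  \<open>K\<close> can determine the weights of the latter users only.\<close>

lemma K_bound_strict_mono:
  assumes "\<And>n. v $ n \<le> w $ n" and "v $ m < w $ m" and "b_lo G $ m \<noteq> 0 \<or> b_hi G $ m \<noteq> 0"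
  shows "K_bound G v < K_bound G w"
proof -
  have "0 < max ((b_hi G $ m)\<^sup>2) ((b_lo G $ m)\<^sup>2)"
    using assms(3) by (auto simp: less_max_iff_disj)
  then have "(\<Sum>n\<in>UNIV. v $ n * max ((b_hi G $ n)\<^sup>2) ((b_lo G $ n)\<^sup>2))
      < (\<Sum>n\<in>UNIV. w $ n * max ((b_hi G $ n)\<^sup>2) ((b_lo G $ n)\<^sup>2))"
    using assms(1,2)
    by (intro sum_strict_mono_ex1 bexI[of _ m] ballI mult_right_mono mult_strict_right_mono)
      (auto simp: le_max_iff_disj)
  then show ?thesis by (simp add: K_bound_def)
qed

lemma K_bound_star:
  "K_bound G (w_star G) = (\<Sum>n\<in>UNIV. max ((b_hi G $ n)\<^sup>2) ((b_lo G $ n)\<^sup>2) / (2 * \<delta> G n))"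
  unfolding K_bound_def w_star_def sum_distrib_left by (intro sum.cong) (auto simp: field_simps)

section \<open>Feasibility of the states of charge\<close>

lemma matrix_vector_mult_mono:
  fixes A :: "real ^ 'n ^ 'm"
  assumes "\<forall>i j. 0 \<le> A $ i $ j" and "x \<le> y"
  shows "A *v x \<le> A *v y"
  using assms by (auto simp: less_eq_vec_def matrix_vector_mult_def intro!: sum_mono mult_left_mono)

text \<open>The voltages lie within limits both at \<open>0\<close>, by (a2), and at
  \<open>b\<close>. As \<open>R\<close> has nonnegative entries they are antitone in the charge, so
  at \<open>b'\<close> they lie between these two admissible profiles. The box contains 0, and
  \<open>b'\<close> keeps the sign of \<open>b\<close>.\<close>

lemma operational_shrink:
  assumes "well_posed G" and "voltage_ok G d (load d)" and "regsig d \<in> {- 1, 1}"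
    and "operational G d b" and b': "0 \<le> b' \<and> b' \<le> b \<or> b \<le> b' \<and> b' \<le> 0"
  shows "operational G d b'"
proof -
  have R: "\<forall>i j. 0 \<le> R_mat G $ i $ j" and box: "b_lo G \<le> 0" "0 \<le> b_hi G"
    using assms(1) by (auto simp: well_posed_def)
  have v: "voltage_ok G d (load d)" "voltage_ok G d (load d + b)"
    using assms by (auto simp: operational_def)
  from b' have "voltage_ok G d (load d + b')"
  proof
    assume "0 \<le> b' \<and> b' \<le> b"
    then have "load d \<le> load d + b'" "load d + b' \<le> load d + b"
      by (auto simp: less_eq_vec_def)
    from this[THEN matrix_vector_mult_mono[OF R]] show ?thesis
      using v unfolding voltage_ok_def less_eq_vec_def by (simp add: less_eq_vec_def) (smt (verit))
  next
    assume "b \<le> b' \<and> b' \<le> 0"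
    then have "load d + b' \<le> load d" "load d + b \<le> load d + b'"
      by (auto simp: less_eq_vec_def)
    from this[THEN matrix_vector_mult_mono[OF R]] show ?thesis
      using v unfolding voltage_ok_def less_eq_vec_def by (simp add: less_eq_vec_def) (smt (verit))
  qed
  moreover have "b_lo G \<le> b' \<and> b' \<le> b_hi G"
    using b' box assms(4) by (auto simp: operational_def)
  moreover have "(regsig d = 1 \<longrightarrow> 0 \<le> b') \<and> (regsig d = - 1 \<longrightarrow> b' \<le> 0)"
    using b' assms(4) by (auto simp: operational_def)
  ultimately show ?thesis by (simp add: operational_def)
qed

text \<open>The summand \<open>\<phi>\<close> is arbitrary so that one identity serves the total
  load, the separable part of the cost and the queue term when a single coordinate moves.\<close>

lemma sum_nth_axis_add:
  fixes b :: "real ^ 'n"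
  shows "(\<Sum>i\<in>UNIV. \<phi> i ((b + axis n h) $ i)) = (\<Sum>i\<in>UNIV. \<phi> i (b $ i)) + (\<phi> n (b $ n + h) - \<phi> n (b $ n) :: real)"
  by (subst (1 2) sum.remove[of _ n]) (auto intro!: sum.cong simp: axis_def)

text \<open>The increment is exact, not a linearization: the square of the total load and the square
  of the load of user \<open>n\<close> each contribute \<open>h / 2\<close> to the slope, which
  together give the summand \<open>h\<close>.\<close>

lemma cost_axis_add:
  "cost d (b + axis n h) = cost d b
     + h * (price0 d + pricep d * ((\<Sum>i\<in>UNIV. (load d + b) $ i) + (load d + b) $ n + h) - regsig d * pricer d)"
proof -
  have 1: "(\<Sum>i\<in>UNIV. (load d + (b + axis n h)) $ i) = (\<Sum>i\<in>UNIV. (load d + b) $ i) + h"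
    using sum_nth_axis_add[where \<phi> = "\<lambda>i x. load d $ i + x"] by simp
  have 2: "(\<Sum>i\<in>UNIV. price0 d * (load d + (b + axis n h)) $ i + pricep d * ((load d + (b + axis n h)) $ i)\<^sup>2 / 2
        - regsig d * pricer d * (b + axis n h) $ i)
      = (\<Sum>i\<in>UNIV. price0 d * (load d + b) $ i + pricep d * ((load d + b) $ i)\<^sup>2 / 2
        - regsig d * pricer d * b $ i)
       + h * (price0 d + pricep d * ((load d + b) $ n + h / 2) - regsig d * pricer d)"
    using sum_nth_axis_add[where b = b and n = n and h = h and \<phi> = "\<lambda>i x. price0 d * (load d $ i + x)
        + pricep d * (load d $ i + x)\<^sup>2 / 2 - regsig d * pricer d * x"]
    by (simp add: algebra_simps power2_eq_square add_divide_distrib)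
  show ?thesis
    unfolding cost_def Let_def 1 2 by (simp add: power2_eq_square algebra_simps add_divide_distrib)
qed

lemma real_time_objective_axis_add:
  "real_time_objective w \<gamma> s d (b + axis n h) = real_time_objective w \<gamma> s d b
     + h * (w $ n * (s $ n + \<gamma> $ n) + price0 d
        + pricep d * ((\<Sum>i\<in>UNIV. (load d + b) $ i) + (load d + b) $ n + h) - regsig d * pricer d)"
  using sum_nth_axis_add[where b = b and n = n and h = h and \<phi> = "\<lambda>i x. w $ i * (s $ i + \<gamma> $ i) * x"]
  unfolding real_time_objective_def cost_axis_add by (simp add: algebra_simps)

text \<open>
  Cancelling the charge of one user keeps the decision operational, and by convexity it changes
  the objective by at least the charge times the marginal cost at \<open>b = 0\<close>.
\<close>

lemma arg_min_not_charging:
  assumes "well_posed G" and "voltage_ok G d (load d)" and "data_ok G d" and "marginal_cost_within G d"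
    and min: "is_arg_min (real_time_objective w \<gamma> s d) (operational G d) b"
    and x: "- g_lo G n < w $ n * (s $ n + \<gamma> $ n)"
  shows "b $ n \<le> 0"
proof (rule ccontr)
  assume pos: "\<not> b $ n \<le> 0"
  define b' where "b' = b + axis n (- b $ n)"
  have b: "operational G d b" and r: "regsig d \<in> {- 1, 1}" and cp: "0 \<le> pricep d"
    using min assms(1,3) by (auto simp: is_arg_min_def data_ok_def well_posed_def)
  \<comment> \<open>The signal is common to all users, so one charging battery excludes discharging
    everywhere.\<close>
  with pos have r1: "regsig d = 1" and b0: "0 \<le> b"
    by (auto simp: operational_def less_eq_vec_def)
  have "0 \<le> b' \<and> b' \<le> b"
    using b0 by (auto simp: b'_def less_eq_vec_def axis_def)
  then have "operational G d b'"
    using operational_shrink[OF assms(1,2) r b] by blast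
  then have "real_time_objective w \<gamma> s d b \<le> real_time_objective w \<gamma> s d b'"
    using min by (auto simp: is_arg_min_def not_less)
  \<comment> \<open>For \<open>h = - b $ n\<close> the own load in the slope reduces to
    \<open>load d $ n\<close>, while the nonnegative charges can only raise the total load. The
    slope is therefore at least the marginal cost at zero charge.\<close>
  moreover have "(\<Sum>i\<in>UNIV. load d $ i) \<le> (\<Sum>i\<in>UNIV. (load d + b) $ i)"
    using b0 by (intro sum_mono) (auto simp: less_eq_vec_def)
  then have "pricep d * ((\<Sum>i\<in>UNIV. load d $ i) + load d $ n)
      \<le> pricep d * ((\<Sum>i\<in>UNIV. (load d + b) $ i) + (load d + b) $ n + - b $ n)"
    using cp by (intro mult_left_mono) auto
  with x assms(4)[unfolded marginal_cost_within_def, rule_format, of n] have "0 < w $ n * (s $ n + \<gamma> $ n) + price0 d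
        + pricep d * ((\<Sum>i\<in>UNIV. (load d + b) $ i) + (load d + b) $ n + - b $ n) - regsig d * pricer d"
    unfolding r1 by linarith
  ultimately show False
    using pos unfolding b'_def real_time_objective_axis_add by (simp add: zero_le_mult_iff mult_le_0_iff)
qed

lemma arg_min_not_discharging:
  assumes "well_posed G" and "voltage_ok G d (load d)" and "data_ok G d" and "marginal_cost_within G d"
    and min: "is_arg_min (real_time_objective w \<gamma> s d) (operational G d) b"
    and x: "w $ n * (s $ n + \<gamma> $ n) < - g_hi G n"
  shows "0 \<le> b $ n"
proof (rule ccontr)
  assume neg: "\<not> 0 \<le> b $ n"
  define b' where "b' = b + axis n (- b $ n)"
  have b: "operational G d b" and r: "regsig d \<in> {- 1, 1}" and cp: "0 \<le> pricep d"
    using min assms(1,3) by (auto simp: is_arg_min_def data_ok_def well_posed_def)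
  with neg have r1: "regsig d = - 1" and b0: "b \<le> 0"
    by (auto simp: operational_def less_eq_vec_def)
  have "b \<le> b' \<and> b' \<le> 0"
    using b0 by (auto simp: b'_def less_eq_vec_def axis_def)
  then have "operational G d b'"
    using operational_shrink[OF assms(1,2) r b] by blast
  then have "real_time_objective w \<gamma> s d b \<le> real_time_objective w \<gamma> s d b'"
    using min by (auto simp: is_arg_min_def not_less)
  moreover have "(\<Sum>i\<in>UNIV. (load d + b) $ i) \<le> (\<Sum>i\<in>UNIV. load d $ i)"
    using b0 by (intro sum_mono) (auto simp: less_eq_vec_def)
  then have "pricep d * ((\<Sum>i\<in>UNIV. (load d + b) $ i) + (load d + b) $ n + - b $ n)
      \<le> pricep d * ((\<Sum>i\<in>UNIV. load d $ i) + load d $ n)"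
    using cp by (intro mult_left_mono) auto
  with x assms(4)[unfolded marginal_cost_within_def, rule_format, of n] have "w $ n * (s $ n + \<gamma> $ n) + price0 d
        + pricep d * ((\<Sum>i\<in>UNIV. (load d + b) $ i) + (load d + b) $ n + - b $ n) - regsig d * pricer d < 0"
    unfolding r1 by linarith
  ultimately show False
    using neg unfolding b'_def real_time_objective_axis_add by (simp add: zero_le_mult_iff mult_le_0_iff)
qed

lemma real_time_soc_feasible:
  assumes "well_posed G" and "params_ok G w \<gamma>" and "real_time G w \<gamma> \<xi> b"
    and d: "\<And>t. data_ok G (\<xi> t)" "\<And>t. voltage_ok G (\<xi> t) (load (\<xi> t))" "\<And>t. marginal_cost_within G (\<xi> t)"
  shows "soc_feasible G b"
proof -
  have "s_lo G $ n \<le> soc (s_init G) b t $ n \<and> soc (s_init G) b t $ n \<le> s_hi G $ n" for n t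
  proof (induction t)
    case 0
    show ?case using assms(1) by (auto simp: well_posed_def less_eq_vec_def)
  next
    case (Suc t)
    let ?s = "soc (s_init G) b t"
    have min: "is_arg_min (real_time_objective w \<gamma> ?s (\<xi> t)) (operational G (\<xi> t)) (b t)"
      using assms(3) by (auto simp: real_time_def)
    then have box: "b_lo G $ n \<le> b t $ n" "b t $ n \<le> b_hi G $ n"
      by (auto simp: is_arg_min_def operational_def less_eq_vec_def)
    have w: "0 < w $ n"
      and lo: "- g_lo G n / w $ n \<le> \<gamma> $ n - b_hi G $ n + s_hi G $ n"
      and hi: "\<gamma> $ n - b_lo G $ n + s_lo G $ n \<le> - g_hi G n / w $ n"
      using assms(2) by (auto simp: params_ok_def algebra_simps)
    \<comment> \<open>Only above this level can a permitted charge overfill the battery. The lower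
      bound on \<open>\<gamma> $ n\<close> is exactly what makes the weighted queue exceed
      \<open>- g_lo G n\<close> there; the upper bound plays the same role for discharging below
      \<open>s_lo G $ n - b_lo G $ n\<close>.\<close>
    have "b t $ n \<le> 0" if "s_hi G $ n - b_hi G $ n < ?s $ n"
    proof (rule arg_min_not_charging[OF assms(1) d(2,1,3) min])
      have "- g_lo G n / w $ n < ?s $ n + \<gamma> $ n" using lo that by linarith
      then show "- g_lo G n < w $ n * (?s $ n + \<gamma> $ n)" by (simp only: pos_divide_less_eq[OF w] mult.commute)
    qed
    moreover have "0 \<le> b t $ n" if "?s $ n < s_lo G $ n - b_lo G $ n"
    proof (rule arg_min_not_discharging[OF assms(1) d(2,1,3) min])
      have "?s $ n + \<gamma> $ n < - g_hi G n / w $ n" using hi that by linarith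
      then show "w $ n * (?s $ n + \<gamma> $ n) < - g_hi G n" by (simp only: pos_less_divide_eq[OF w] mult.commute)
    qed
    ultimately show ?case using Suc.IH box by (simp; linarith)
  qed
  then show ?thesis by (auto simp: soc_feasible_def less_eq_vec_def)
qed

section \<open>Measurability and boundedness of the real-time problem\<close>

lemma continuous_on_datum [continuous_intros]:
  assumes "continuous_on A f"
  shows "continuous_on A (\<lambda>x. load (f x))" and "continuous_on A (\<lambda>x. rload (f x))"
    and "continuous_on A (\<lambda>x. regsig (f x))" and "continuous_on A (\<lambda>x. price0 (f x))"
    and "continuous_on A (\<lambda>x. pricep (f x))" and "continuous_on A (\<lambda>x. pricer (f x))"
  using assms unfolding load_def rload_def regsig_def price0_def pricep_def pricer_def case_prod_unfold
  by (auto intro!: continuous_intros)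

lemma continuous_on_real_time_objective [continuous_intros]:
  assumes "continuous_on A s" and "continuous_on A d" and "continuous_on A b"
  shows "continuous_on A (\<lambda>x. real_time_objective w \<gamma> (s x) (d x) (b x))"
  using assms unfolding real_time_objective_def cost_def Let_def by (auto intro!: continuous_intros)

text \<open>Through zero weights, measurability and boundedness of the cost follow from those of the
  objective.\<close>

lemma real_time_objective_zero: "real_time_objective 0 \<gamma> s d b = cost d b"
  by (simp add: real_time_objective_def)

lemma borel_measurable_component [measurable (raw)]:
  fixes f :: "'a \<Rightarrow> real ^ 'n"
  assumes "f \<in> borel_measurable M"
  shows "(\<lambda>x. f x $ n) \<in> borel_measurable M"
  by (rule measurable_compose[OF assms borel_measurable_nth])

lemma borel_measurable_real_time_objective [measurable (raw)]:
  assumes "s \<in> borel_measurable M" and "d \<in> borel_measurable M" and "b \<in> borel_measurable M"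
  shows "(\<lambda>x. real_time_objective w \<gamma> (s x) (d x) (b x)) \<in> borel_measurable M"
proof -
  have "(\<lambda>x. (s x, d x, b x)) \<in> borel_measurable M"
    using assms by (intro borel_measurable_Pair)
  moreover have "(\<lambda>z. real_time_objective w \<gamma> (fst z) (fst (snd z)) (snd (snd z))) \<in> borel_measurable borel"
    by (intro borel_measurable_continuous_onI continuous_intros)
  ultimately show ?thesis
    by (auto dest: measurable_compose)
qed

lemma borel_measurable_cost [measurable (raw)]:
  assumes "d \<in> borel_measurable M" and "b \<in> borel_measurable M"
  shows "(\<lambda>x. cost (d x) (b x)) \<in> borel_measurable M"
  using borel_measurable_real_time_objective[OF borel_measurable_const assms, of 0 0 0]
  by (simp add: real_time_objective_zero)

text \<open>Each sublevel set of the minimum value is the projection of a closed set along the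
  compact factor \<open>K\<close>, hence closed. So the value is lower semicontinuous and in
  particular Borel.\<close>

lemma borel_measurable_min_value:
  fixes g :: "'a::euclidean_space \<times> 'b::euclidean_space \<Rightarrow> real"
  assumes K: "compact K" and C: "closed C" and g: "continuous_on UNIV g"
    and ne: "\<And>y. \<exists>x\<in>K. (x, y) \<in> C"
  shows "\<exists>V\<in>borel_measurable borel. \<forall>y. (\<forall>x\<in>K. (x, y) \<in> C \<longrightarrow> V y \<le> g (x, y)) \<and>
           (\<exists>x\<in>K. (x, y) \<in> C \<and> V y = g (x, y))"
proof -
  have "\<exists>x\<in>K \<inter> (\<lambda>x. (x, y)) -` C. \<forall>z\<in>K \<inter> (\<lambda>x. (x, y)) -` C. g (x, y) \<le> g (z, y)" for y
  proof (rule continuous_attains_inf)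
    have "closed ((\<lambda>x. (x, y)) -` C)"
      by (intro continuous_closed_vimage C continuous_intros)
    then show "compact (K \<inter> (\<lambda>x. (x, y)) -` C)" by (rule compact_Int_closed[OF K])
    show "K \<inter> (\<lambda>x. (x, y)) -` C \<noteq> {}" using ne[of y] by auto
    show "continuous_on (K \<inter> (\<lambda>x. (x, y)) -` C) (\<lambda>x. g (x, y))"
      by (rule continuous_on_compose2[OF g]) (auto intro!: continuous_intros)
  qed
  \<comment> \<open>The minimizer is picked pointwise and may fail to be measurable; only its value
    is used.\<close>
  then obtain \<beta> where \<beta>: "\<And>y. \<beta> y \<in> K" "\<And>y. (\<beta> y, y) \<in> C"
      "\<And>y z. z \<in> K \<Longrightarrow> (z, y) \<in> C \<Longrightarrow> g (\<beta> y, y) \<le> g (z, y)"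
    by (simp add: Bex_def Ball_def) metis
  have "closed {y. g (\<beta> y, y) \<le> c}" for c
  proof -
    have "{y. g (\<beta> y, y) \<le> c} = {y. \<exists>x. x \<in> K \<and> (x, y) \<in> C \<inter> {z. g z \<le> c}}"
      by (auto intro: \<beta>(1,2) order_trans[OF \<beta>(3)])
    also have "closed \<dots>"
      by (intro closed_compact_projection K closed_Int C closed_Collect_le g continuous_on_const)
    finally show ?thesis .
  qed
  then have "(\<lambda>y. g (\<beta> y, y)) \<in> borel_measurable borel"
    by (auto simp: borel_measurable_iff_le)
  with \<beta> show ?thesis by (intro bexI[of _ "\<lambda>y. g (\<beta> y, y)"]) auto
qed

text \<open>
  Admitting \<open>b = 0\<close> for every datum makes the constraint set nonempty everywhere; on data that satisfy (a2)
  it adds nothing. Writing the sign constraint as \<open>0 \<le> r b\<^sub>n\<close> makes it closed in \<open>r\<close>.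
\<close>

lemma borel_measurable_real_time_value:
  fixes G :: "('n::finite) grid_params"
  assumes "well_posed G"
  shows "\<exists>V\<in>borel_measurable borel. \<forall>s d. data_ok G d \<and> voltage_ok G d (load d) \<longrightarrow>
           (\<forall>b. operational G d b \<longrightarrow> V (s, d) \<le> real_time_objective w \<gamma> s d b) \<and>
           (\<exists>b. operational G d b \<and> V (s, d) = real_time_objective w \<gamma> s d b)"
proof -
  define K where "K = {b_lo G..b_hi G}"
  define C where "C = {x. voltage_ok G (snd (snd x)) (load (snd (snd x)) + fst x) \<and>
      (\<forall>n. 0 \<le> regsig (snd (snd x)) * fst x $ n)} \<union> {x :: (real ^ 'n) \<times> (real ^ 'n) \<times> 'n datum. fst x = 0}"
  have 0: "b_lo G \<le> 0" "0 \<le> b_hi G" using assms by (auto simp: well_posed_def)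
  have "compact K"
    unfolding K_def by (rule compact_interval)
  moreover have "closed C"
    unfolding C_def voltage_ok_def less_eq_vec_def matrix_vector_mult_def
    by (intro closed_Un closed_Collect_conj closed_Collect_all closed_Collect_le closed_Collect_eq)
      (auto intro!: continuous_intros)
  moreover have "continuous_on UNIV (\<lambda>x. real_time_objective w \<gamma> (fst (snd x)) (snd (snd x)) (fst x))"
    by (intro continuous_intros)
  moreover have "\<exists>b\<in>K. (b, y) \<in> C" for y
    using 0 by (intro bexI[of _ 0]) (auto simp: C_def K_def)
  ultimately obtain V where V: "V \<in> borel_measurable borel"
    and min: "\<And>y b. b \<in> K \<Longrightarrow> (b, y) \<in> C \<Longrightarrow> V y \<le> real_time_objective w \<gamma> (fst y) (snd y) b"
    and att: "\<And>y. \<exists>b\<in>K. (b, y) \<in> C \<and> V y = real_time_objective w \<gamma> (fst y) (snd y) b"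
    using borel_measurable_min_value[of K C "\<lambda>x. real_time_objective w \<gamma> (fst (snd x)) (snd (snd x)) (fst x)"]
    unfolding fst_conv snd_conv by blast
  have iff: "b \<in> K \<and> (b, s, d) \<in> C \<longleftrightarrow> operational G d b"
    if "data_ok G d" "voltage_ok G d (load d)" for s d b
  proof -
    have "regsig d = 1 \<or> regsig d = - 1" using that by (auto simp: data_ok_def)
    then have "(\<forall>n. 0 \<le> regsig d * b $ n) \<longleftrightarrow> (regsig d = 1 \<longrightarrow> 0 \<le> b) \<and> (regsig d = - 1 \<longrightarrow> b \<le> 0)"
      by (auto simp: less_eq_vec_def)
    moreover have "operational G d 0"
      using that 0 by (simp add: operational_def)
    ultimately show ?thesis
      by (auto simp: C_def K_def operational_def)
  qed
  show ?thesis
  proof (intro bexI[OF _ V] allI impI conjI)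
    fix s d b assume d: "data_ok G d \<and> voltage_ok G d (load d)" and "operational G d b"
    then show "V (s, d) \<le> real_time_objective w \<gamma> s d b"
      using min[of b "(s, d)"] iff[of d b s] by simp
  next
    fix s d assume d: "data_ok G d \<and> voltage_ok G d (load d)"
    show "\<exists>b. operational G d b \<and> V (s, d) = real_time_objective w \<gamma> s d b"
      using att[of "(s, d)"] iff[of d _ s] d by auto
  qed
qed

text \<open>Admissible data and decisions, and states in a ball, form a subset of a compact set on
  which the objective is continuous. The resulting bound supplies integrability later.\<close>

lemma real_time_objective_bounded:
  fixes G :: "('n::finite) grid_params"
  shows "\<exists>B. \<forall>s d b. norm s \<le> r \<and> data_ok G d \<and> operational G d b \<longrightarrow>
    \<bar>real_time_objective w \<gamma> s d b\<bar> \<le> B"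
proof -
  let ?D = "{load_lo G..load_hi G} \<times> {rload_lo G..rload_hi G} \<times> {- 1..1 :: real} \<times>
    {c0_lo G..c0_hi G} \<times> {cp_lo G..cp_hi G} \<times> {cr_lo G..cr_hi G}"
  let ?g = "\<lambda>x. real_time_objective w \<gamma> (fst x) (fst (snd x)) (snd (snd x))"
  have "compact (cball (0 :: real ^ 'n) r \<times> ?D \<times> {b_lo G..b_hi G})"
    by (intro compact_Times compact_interval compact_cball)
  then have "compact (?g ` (cball (0 :: real ^ 'n) r \<times> ?D \<times> {b_lo G..b_hi G}))"
    by (intro compact_continuous_image continuous_intros)
  then obtain B where B: "\<And>x. x \<in> cball (0 :: real ^ 'n) r \<times> ?D \<times> {b_lo G..b_hi G} \<Longrightarrow> \<bar>?g x\<bar> \<le> B"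
    unfolding real_norm_def[symmetric] using compact_imp_bounded bounded_iff by (metis (no_types, lifting) imageI)
  have "d \<in> ?D" if "data_ok G d" for d
    using that by (cases d) (auto simp: data_ok_def load_def rload_def regsig_def price0_def pricep_def pricer_def)
  then have "\<bar>real_time_objective w \<gamma> s d b\<bar> \<le> B"
    if "norm s \<le> r" "data_ok G d" "operational G d b" for s d b
    using B[of "(s, d, b)"] that by (auto simp: operational_def)
  then show ?thesis by blast
qed

lemma cost_bounded:
  "\<exists>B. \<forall>d b. data_ok G d \<and> operational G d b \<longrightarrow> \<bar>cost d b\<bar> \<le> B"
  using real_time_objective_bounded[of 0 G 0 0] by (metis norm_zero order_refl real_time_objective_zero)

lemma soc_eq_sum: "soc s b t = s + (\<Sum>u<t. b u)"
  by (induction t) auto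

text \<open>The radius may grow with \<open>t\<close>. It serves integrability at a fixed time,
  where only the charge limits are available and not the limits on the state.\<close>

lemma soc_bounded: "\<exists>r. \<forall>b. (\<forall>u. b_lo G \<le> b u \<and> b u \<le> b_hi G) \<longrightarrow> norm (soc s b t) \<le> r"
proof -
  obtain B where B: "\<And>x. x \<in> {b_lo G..b_hi G} \<Longrightarrow> norm x \<le> B"
    using compact_imp_bounded[OF compact_interval] unfolding bounded_iff by blast
  have "norm (soc s b t) \<le> norm s + real t * B" if "\<forall>u. b_lo G \<le> b u \<and> b u \<le> b_hi G" for b
  proof -
    have "norm (\<Sum>u<t. b u) \<le> real (card {..<t}) * B"
      using that B by (intro sum_norm_bound) auto
    then show ?thesis
      unfolding soc_eq_sum using norm_triangle_ineq[of s "\<Sum>u<t. b u"] by simp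
  qed
  then show ?thesis by blast
qed

section \<open>Independence and comparison with a competitor\<close>

lemma (in prob_space) integrable_boundedI:
  fixes f :: "'a \<Rightarrow> real"
  assumes "f \<in> borel_measurable M" and "\<And>x. x \<in> space M \<Longrightarrow> \<bar>f x\<bar> \<le> B"
  shows "integrable M f"
  using assms by (intro integrable_const_bound[where B = B]) auto

lemma (in prob_space) iid_borel_measurable:
  assumes "iid M \<xi>"
  shows "\<xi> t \<in> borel_measurable M"
  using assms by (auto simp: iid_def indep_vars_def)

lemma (in prob_space) causal_borel_measurable:
  assumes "iid M \<xi>" and "causal M \<xi> b"
  shows "b t \<in> borel_measurable M"
proof -
  obtain F where F: "F \<in> borel_measurable (Pi\<^sub>M {..t} (\<lambda>_. borel))"
    "\<forall>\<omega>\<in>space M. b t \<omega> = F (\<lambda>i\<in>{..t}. \<xi> i \<omega>)"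
    using assms(2) unfolding causal_def by blast
  have "(\<lambda>\<omega>. \<lambda>i\<in>{..t}. \<xi> i \<omega>) \<in> measurable M (Pi\<^sub>M {..t} (\<lambda>_. borel))"
    by (intro measurable_restrict iid_borel_measurable[OF assms(1)])
  from measurable_compose[OF this F(1)] show ?thesis
    using F(2) by (simp cong: measurable_cong)
qed

text \<open>The state of charge at time \<open>t\<close> is a function of the data before \<open>t\<close>.\<close>

lemma (in prob_space) soc_indep_datum:
  assumes "iid M \<xi>" and "causal M \<xi> b"
  shows "distr M (borel \<Otimes>\<^sub>M borel) (\<lambda>\<omega>. (soc s (\<lambda>u. b u \<omega>) t, \<xi> t \<omega>))
    = distr M borel (\<lambda>\<omega>. soc s (\<lambda>u. b u \<omega>) t) \<Otimes>\<^sub>M distr M borel (\<xi> t)"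
proof -
  have "\<forall>u. \<exists>F. F \<in> borel_measurable (Pi\<^sub>M {..u} (\<lambda>_. borel)) \<and>
      (\<forall>\<omega>\<in>space M. b u \<omega> = F (\<lambda>i\<in>{..u}. \<xi> i \<omega>))"
    using assms(2) unfolding causal_def by blast
  then obtain F where F: "\<And>u. F u \<in> borel_measurable (Pi\<^sub>M {..u} (\<lambda>_. borel))"
    "\<And>u \<omega>. \<omega> \<in> space M \<Longrightarrow> b u \<omega> = F u (\<lambda>i\<in>{..u}. \<xi> i \<omega>)"
    by metis
  \<comment> \<open>\<open>H\<close> rebuilds the state from the history before \<open>t\<close>;
    the restriction hands each \<open>F u\<close> only the data up to \<open>u\<close>.\<close>
  define H where "H h = s + (\<Sum>u<t. F u (restrict h {..u}))" for h
  have "(\<lambda>h. F u (restrict h {..u})) \<in> borel_measurable (Pi\<^sub>M {..<t} (\<lambda>_. borel))" if "u < t" for u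
    using that by (intro measurable_compose[OF measurable_restrict_subset F(1)]) auto
  then have H: "H \<in> borel_measurable (Pi\<^sub>M {..<t} (\<lambda>_. borel))"
    unfolding H_def by (intro borel_measurable_add borel_measurable_const borel_measurable_sum) auto
  let ?A = "Pi\<^sub>M {..<t} (\<lambda>_. borel)" and ?B = "Pi\<^sub>M {t} (\<lambda>_. borel)"
  let ?X = "\<lambda>\<omega>. \<lambda>i\<in>{..<t}. \<xi> i \<omega>" and ?Y = "\<lambda>\<omega>. \<lambda>i\<in>{t}. \<xi> i \<omega>"
  \<comment> \<open>The index blocks \<open>{..<t}\<close> and \<open>{t}\<close> are
    disjoint.\<close>
  have "indep_var ?A ?X ?B ?Y"
    using assms(1) by (intro indep_var_restrict[where I = UNIV]) (auto simp: iid_def)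
  then have XY: "?X \<in> measurable M ?A" "?Y \<in> measurable M ?B"
    and law: "distr M ?A ?X \<Otimes>\<^sub>M distr M ?B ?Y = distr M (?A \<Otimes>\<^sub>M ?B) (\<lambda>\<omega>. (?X \<omega>, ?Y \<omega>))"
    unfolding indep_var_distribution_eq by auto
  have E: "(\<lambda>h. h t) \<in> measurable ?B borel"
    by (intro measurable_component_singleton) simp
  have S: "soc s (\<lambda>u. b u \<omega>) t = H (?X \<omega>)" if "\<omega> \<in> space M" for \<omega>
  proof -
    have "F u (restrict (?X \<omega>) {..u}) = b u \<omega>" if "u < t" for u
    proof -
      have "restrict (?X \<omega>) {..u} = (\<lambda>i\<in>{..u}. \<xi> i \<omega>)"
        using that by (auto simp: restrict_def fun_eq_iff)
      then show ?thesis using F(2) \<open>\<omega> \<in> space M\<close> by simp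
    qed
    then show ?thesis by (simp add: H_def soc_eq_sum)
  qed
  have "distr M borel (\<lambda>\<omega>. soc s (\<lambda>u. b u \<omega>) t) = distr (distr M ?A ?X) borel H"
    by (subst distr_distr[OF H XY(1)]) (auto intro!: distr_cong simp: S)
  moreover have "distr M borel (\<xi> t) = distr (distr M ?B ?Y) borel (\<lambda>h. h t)"
    by (subst distr_distr[OF E XY(2)]) (auto intro!: distr_cong)
  moreover have "distr (distr M ?A ?X) borel H \<Otimes>\<^sub>M distr (distr M ?B ?Y) borel (\<lambda>h. h t)
      = distr (distr M ?A ?X \<Otimes>\<^sub>M distr M ?B ?Y) (borel \<Otimes>\<^sub>M borel) (\<lambda>(x, y). (H x, y t))"
  proof (rule pair_measure_distr)
    show "H \<in> measurable (distr M ?A ?X) borel" "(\<lambda>h. h t) \<in> measurable (distr M ?B ?Y) borel"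
      using H E by simp_all
    show "sigma_finite_measure (distr (distr M ?B ?Y) borel (\<lambda>h. h t))"
      by (intro prob_space_imp_sigma_finite prob_space.prob_space_distr prob_space_distr XY) (use E in simp)
  qed
  moreover have "\<dots> = distr M (borel \<Otimes>\<^sub>M borel) (\<lambda>\<omega>. (soc s (\<lambda>u. b u \<omega>) t, \<xi> t \<omega>))"
  proof -
    have "(\<lambda>(x, y). (H x, y t)) \<in> measurable (?A \<Otimes>\<^sub>M ?B) (borel \<Otimes>\<^sub>M borel)"
      using H E by (auto simp: case_prod_unfold intro!: measurable_Pair)
    then show ?thesis
      unfolding law by (subst distr_distr) (auto intro!: distr_cong measurable_Pair XY simp: S)
  qed
  ultimately show ?thesis by simp
qed

text \<open>On the product space the state depends on the first coordinate, the datum and the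
  competitor on the second. The expected queue term thus factors into means even if \<open>c\<close>
  depends on the whole data sequence.\<close>

lemma (in prob_space) real_time_objective_le_competitor:
  fixes \<xi> :: "nat \<Rightarrow> 'a \<Rightarrow> 'n::finite datum"
  assumes wp: "well_posed G"
    and d: "\<And>t \<omega>. \<omega> \<in> space M \<Longrightarrow> data_ok G (\<xi> t \<omega>)"
    and a2: "\<And>t \<omega>. \<omega> \<in> space M \<Longrightarrow> voltage_ok G (\<xi> t \<omega>) (load (\<xi> t \<omega>))"
    and rt: "\<And>\<omega>. \<omega> \<in> space M \<Longrightarrow> real_time G w \<gamma> (\<lambda>t. \<xi> t \<omega>) (\<lambda>t. b t \<omega>)"
    and iid: "iid M \<xi>" and causal: "causal M \<xi> b"
    and c[measurable]: "c \<in> borel_measurable M"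
    and oc: "\<And>\<omega>. \<omega> \<in> space M \<Longrightarrow> operational G (\<xi> \<tau> \<omega>) (c \<omega>)"
  shows "expectation (\<lambda>\<omega>. real_time_objective w \<gamma> (soc (s_init G) (\<lambda>t. b t \<omega>) t) (\<xi> t \<omega>) (b t \<omega>))
    \<le> (\<Sum>n\<in>UNIV. w $ n * (expectation (\<lambda>\<omega>. soc (s_init G) (\<lambda>t. b t \<omega>) t $ n) + \<gamma> $ n)
           * expectation (\<lambda>\<omega>. c \<omega> $ n))
      + expectation (\<lambda>\<omega>. cost (\<xi> \<tau> \<omega>) (c \<omega>))"
proof -
  define S where "S \<omega> = soc (s_init G) (\<lambda>t. b t \<omega>) t" for \<omega>
  interpret P: pair_prob_space M M ..
  note [measurable] = iid_borel_measurable[OF iid] causal_borel_measurable[OF iid causal]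
  have min: "is_arg_min (real_time_objective w \<gamma> (soc (s_init G) (\<lambda>t. b t \<omega>) u) (\<xi> u \<omega>)) (operational G (\<xi> u \<omega>)) (b u \<omega>)"
    if "\<omega> \<in> space M" for u \<omega>
    using rt[OF that] by (auto simp: real_time_def)
  then have box: "b_lo G \<le> b u \<omega> \<and> b u \<omega> \<le> b_hi G" if "\<omega> \<in> space M" for u \<omega>
    using that by (auto simp: is_arg_min_def operational_def)
  obtain r where "\<And>b. (\<forall>u. b_lo G \<le> b u \<and> b u \<le> b_hi G) \<Longrightarrow> norm (soc (s_init G) b t) \<le> r"
    using soc_bounded[of G "s_init G" t] by blast
  with box have r: "\<And>\<omega>. \<omega> \<in> space M \<Longrightarrow> norm (S \<omega>) \<le> r"
    unfolding S_def by simp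
  have [measurable]: "S \<in> borel_measurable M"
    unfolding S_def soc_eq_sum by measurable
  obtain V where V[measurable]: "V \<in> borel_measurable borel"
    and V_le: "\<And>s d b. data_ok G d \<Longrightarrow> voltage_ok G d (load d) \<Longrightarrow> operational G d b
        \<Longrightarrow> V (s, d) \<le> real_time_objective w \<gamma> s d b"
    and V_att: "\<And>s d. data_ok G d \<Longrightarrow> voltage_ok G d (load d)
        \<Longrightarrow> \<exists>b. operational G d b \<and> V (s, d) = real_time_objective w \<gamma> s d b"
    using borel_measurable_real_time_value[OF wp, of w \<gamma>] by blast
  obtain B where B: "\<And>s d b. norm s \<le> r \<Longrightarrow> data_ok G d \<Longrightarrow> operational G d b
      \<Longrightarrow> \<bar>real_time_objective w \<gamma> s d b\<bar> \<le> B"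
    using real_time_objective_bounded[of r G w \<gamma>] by blast
  obtain B' where B': "\<And>d b. data_ok G d \<Longrightarrow> operational G d b \<Longrightarrow> \<bar>cost d b\<bar> \<le> B'"
    using cost_bounded[of G] by blast
  \<comment> \<open>Passing to the minimum value removes the decision itself, so the expectation
    depends only on the joint law of state and datum.\<close>
  have V_b: "real_time_objective w \<gamma> (S \<omega>) (\<xi> t \<omega>) (b t \<omega>) = V (S \<omega>, \<xi> t \<omega>)" if "\<omega> \<in> space M" for \<omega>
  proof (rule antisym)
    show "real_time_objective w \<gamma> (S \<omega>) (\<xi> t \<omega>) (b t \<omega>) \<le> V (S \<omega>, \<xi> t \<omega>)"
      using V_att[OF d[OF that] a2[OF that], of t "S \<omega>"] min[OF that, of t]
      unfolding S_def by (auto simp: is_arg_min_def not_less)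
    show "V (S \<omega>, \<xi> t \<omega>) \<le> real_time_objective w \<gamma> (S \<omega>) (\<xi> t \<omega>) (b t \<omega>)"
      using min[OF that, of t] by (intro V_le d a2 that) (auto simp: is_arg_min_def)
  qed
  have "distr M borel (\<xi> t) = distr M borel (\<xi> \<tau>)"
    using iid unfolding iid_def by metis
  moreover have "distr M (borel \<Otimes>\<^sub>M borel) (\<lambda>\<omega>. (S \<omega>, \<xi> t \<omega>)) = distr M borel S \<Otimes>\<^sub>M distr M borel (\<xi> t)"
    unfolding S_def by (rule soc_indep_datum[OF iid causal])
  moreover have "distr M borel S \<Otimes>\<^sub>M distr M borel (\<xi> \<tau>)
      = distr (M \<Otimes>\<^sub>M M) (borel \<Otimes>\<^sub>M borel) (\<lambda>(x, y). (S x, \<xi> \<tau> y))"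
    by (intro pair_measure_distr prob_space_imp_sigma_finite prob_space_distr) simp_all
  \<comment> \<open>Independence splits the joint law, and identical distribution replaces
    \<open>\<xi> t\<close> by \<open>\<xi> \<tau>\<close>.\<close>
  ultimately have law: "distr M (borel \<Otimes>\<^sub>M borel) (\<lambda>\<omega>. (S \<omega>, \<xi> t \<omega>))
      = distr (M \<Otimes>\<^sub>M M) (borel \<Otimes>\<^sub>M borel) (\<lambda>(x, y). (S x, \<xi> \<tau> y))"
    by simp
  have V': "V \<in> borel_measurable (borel \<Otimes>\<^sub>M borel)"
    by (simp add: borel_prod)
  have int: "integrable (M \<Otimes>\<^sub>M M) (\<lambda>z. real_time_objective w \<gamma> (S (fst z)) (\<xi> \<tau> (snd z)) (c (snd z)))"
    by (intro P.integrable_boundedI[where B = B] B r d oc) (simp_all add: space_pair_measure mem_Times_iff)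
  have "expectation (\<lambda>\<omega>. real_time_objective w \<gamma> (S \<omega>) (\<xi> t \<omega>) (b t \<omega>)) = expectation (\<lambda>\<omega>. V (S \<omega>, \<xi> t \<omega>))"
    by (intro Bochner_Integration.integral_cong refl V_b)
  also have "\<dots> = integral\<^sup>L (distr M (borel \<Otimes>\<^sub>M borel) (\<lambda>\<omega>. (S \<omega>, \<xi> t \<omega>))) V"
    by (rule integral_distr[symmetric]) (use V' in measurable)
  also have "\<dots> = (\<integral>z. V (S (fst z), \<xi> \<tau> (snd z)) \<partial>(M \<Otimes>\<^sub>M M))"
    unfolding law by (subst integral_distr) (use V' in \<open>auto simp: case_prod_unfold\<close>)
  also have "\<dots> \<le> (\<integral>z. real_time_objective w \<gamma> (S (fst z)) (\<xi> \<tau> (snd z)) (c (snd z)) \<partial>(M \<Otimes>\<^sub>M M))"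
  proof (rule integral_mono[OF _ int])
    have "\<bar>V (S x, \<xi> \<tau> y)\<bar> \<le> B" if "x \<in> space M" "y \<in> space M" for x y
      using V_att[OF d[OF that(2)] a2[OF that(2)], of \<tau> "S x"] B[OF r[OF that(1)] d[OF that(2)]] by metis
    then show "integrable (M \<Otimes>\<^sub>M M) (\<lambda>z. V (S (fst z), \<xi> \<tau> (snd z)))"
      by (intro P.integrable_boundedI[where B = B]) (auto simp: space_pair_measure)
    show "V (S (fst z), \<xi> \<tau> (snd z)) \<le> real_time_objective w \<gamma> (S (fst z)) (\<xi> \<tau> (snd z)) (c (snd z))"
      if "z \<in> space (M \<Otimes>\<^sub>M M)" for z
      using that by (intro V_le d a2 oc) (auto simp: space_pair_measure)
  qed
  also have "\<dots> = (\<integral>x. (\<integral>y. real_time_objective w \<gamma> (S x) (\<xi> \<tau> y) (c y) \<partial>M) \<partial>M)"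
    using P.integral_fst'[OF int] by simp
  also have "\<dots> = (\<integral>x. (\<Sum>n\<in>UNIV. w $ n * (S x $ n + \<gamma> $ n) * expectation (\<lambda>\<omega>. c \<omega> $ n))
      + expectation (\<lambda>\<omega>. cost (\<xi> \<tau> \<omega>) (c \<omega>)) \<partial>M)"
  proof (intro Bochner_Integration.integral_cong refl)
    fix x
    have "b_lo G $ n \<le> c \<omega> $ n \<and> c \<omega> $ n \<le> b_hi G $ n" if "\<omega> \<in> space M" for \<omega> n
      using oc[OF that] by (auto simp: operational_def less_eq_vec_def)
    then have "integrable M (\<lambda>\<omega>. c \<omega> $ n)" for n
      by (intro integrable_boundedI[where B = "\<bar>b_lo G $ n\<bar> + \<bar>b_hi G $ n\<bar>"]) (simp, smt (verit))
    moreover have "integrable M (\<lambda>\<omega>. cost (\<xi> \<tau> \<omega>) (c \<omega>))"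
      by (intro integrable_boundedI[where B = B'] B' d oc) simp_all
    ultimately show "(\<integral>y. real_time_objective w \<gamma> (S x) (\<xi> \<tau> y) (c y) \<partial>M)
        = (\<Sum>n\<in>UNIV. w $ n * (S x $ n + \<gamma> $ n) * expectation (\<lambda>\<omega>. c \<omega> $ n))
          + expectation (\<lambda>\<omega>. cost (\<xi> \<tau> \<omega>) (c \<omega>))"
      by (simp add: real_time_objective_def)
  qed
  also have "\<dots> = (\<Sum>n\<in>UNIV. w $ n * (expectation (\<lambda>\<omega>. S \<omega> $ n) + \<gamma> $ n) * expectation (\<lambda>\<omega>. c \<omega> $ n))
      + expectation (\<lambda>\<omega>. cost (\<xi> \<tau> \<omega>) (c \<omega>))"
  proof -
    have "integrable M (\<lambda>\<omega>. S \<omega> $ n)" for n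
      using r by (intro integrable_boundedI[where B = r]) (auto intro: order_trans[OF component_le_norm_cart])
    then show ?thesis by (simp add: prob_space)
  qed
  finally show ?thesis unfolding S_def .
qed

section \<open>Lyapunov drift and the long-run cost\<close>

text \<open>The factor 1/2 makes the linear part of the drift equal to the queue term of the
  objective.\<close>

definition lyapunov :: "real ^ 'n \<Rightarrow> real ^ 'n \<Rightarrow> real ^ 'n \<Rightarrow> real" where
  "lyapunov w \<gamma> s = (\<Sum>n\<in>UNIV. w $ n * (s $ n + \<gamma> $ n)\<^sup>2) / 2"

lemma lyapunov_nonneg: "(\<And>n. 0 \<le> w $ n) \<Longrightarrow> 0 \<le> lyapunov w \<gamma> s"
  by (auto simp: lyapunov_def intro!: sum_nonneg)

text \<open>Expanding the square leaves, besides the queue term, half the weighted sum of squared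
  charges. The charge limits bound it by \<open>K\<close>.\<close>

lemma lyapunov_drift:
  assumes "\<And>n. 0 \<le> w $ n" and "b_lo G \<le> b" and "b \<le> b_hi G"
  shows "lyapunov w \<gamma> (s + b) + cost d b \<le> lyapunov w \<gamma> s + K_bound G w + real_time_objective w \<gamma> s d b"
proof -
  have "(\<Sum>n\<in>UNIV. w $ n * (s $ n + b $ n + \<gamma> $ n)\<^sup>2)
      \<le> (\<Sum>n\<in>UNIV. w $ n * (s $ n + \<gamma> $ n)\<^sup>2 + w $ n * max ((b_hi G $ n)\<^sup>2) ((b_lo G $ n)\<^sup>2)
          + 2 * (w $ n * (s $ n + \<gamma> $ n) * b $ n))"
  proof (rule sum_mono)
    fix n
    have "b_lo G $ n \<le> b $ n" "b $ n \<le> b_hi G $ n"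
      using assms(2,3) by (auto simp: less_eq_vec_def)
    then have "\<bar>b $ n\<bar> \<le> max \<bar>b_hi G $ n\<bar> \<bar>b_lo G $ n\<bar>"
      by linarith
    then have "(b $ n)\<^sup>2 \<le> max ((b_hi G $ n)\<^sup>2) ((b_lo G $ n)\<^sup>2)"
      by (auto simp: le_max_iff_disj abs_le_square_iff)
    from mult_left_mono[OF this assms(1)[of n]]
    show "w $ n * (s $ n + b $ n + \<gamma> $ n)\<^sup>2 \<le> w $ n * (s $ n + \<gamma> $ n)\<^sup>2
        + w $ n * max ((b_hi G $ n)\<^sup>2) ((b_lo G $ n)\<^sup>2) + 2 * (w $ n * (s $ n + \<gamma> $ n) * b $ n)"
      by (simp add: power2_eq_square algebra_simps)
  qed
  then show ?thesis
    by (simp add: lyapunov_def K_bound_def real_time_objective_def sum.distrib sum_distrib_left[symmetric])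
qed

lemma borel_measurable_lyapunov [measurable (raw)]:
  assumes [measurable]: "s \<in> borel_measurable M"
  shows "(\<lambda>x. lyapunov w \<gamma> (s x)) \<in> borel_measurable M"
  unfolding lyapunov_def by measurable

lemma lyapunov_bounded:
  fixes w :: "real ^ 'n"
  shows "\<exists>B. \<forall>s. norm s \<le> r \<longrightarrow> \<bar>lyapunov w \<gamma> s\<bar> \<le> B"
proof -
  have "compact (lyapunov w \<gamma> ` cball 0 r)"
    unfolding lyapunov_def by (intro compact_continuous_image compact_cball) (auto intro!: continuous_intros)
  then obtain B where "\<forall>x\<in>lyapunov w \<gamma> ` cball 0 r. norm x \<le> B"
    using compact_imp_bounded bounded_iff by metis
  then show ?thesis by (intro exI[of _ B]) auto
qed

text \<open>
  The competitor at every time \<open>\<tau>\<close> is compared with the real-time decision at one fixed time \<open>t\<close>. Averaging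
  over \<open>\<tau> < T\<close> and letting \<open>T \<rightarrow> \<infinity>\<close> for fixed \<open>t\<close> removes the queue term, since the charges
  of the competitor average to 0, so no bound on the queues that is uniform in \<open>t\<close> is needed.
\<close>

lemma (in prob_space) real_time_long_run_cost_le:
  fixes \<xi> :: "nat \<Rightarrow> 'a \<Rightarrow> 'n::finite datum"
  assumes wp: "well_posed G" and w: "\<And>n. 0 \<le> w $ n"
    and d: "\<And>t \<omega>. \<omega> \<in> space M \<Longrightarrow> data_ok G (\<xi> t \<omega>)"
    and a2: "\<And>t \<omega>. \<omega> \<in> space M \<Longrightarrow> voltage_ok G (\<xi> t \<omega>) (load (\<xi> t \<omega>))"
    and rt: "\<And>\<omega>. \<omega> \<in> space M \<Longrightarrow> real_time G w \<gamma> (\<lambda>t. \<xi> t \<omega>) (\<lambda>t. b t \<omega>)"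
    and iid: "iid M \<xi>" and causal: "causal M \<xi> b"
    and L: "long_run_cost M \<xi> b L" and v: "v \<in> attainable_costs G M \<xi>"
  shows "L \<le> K_bound G w + v"
proof -
  note [measurable] = iid_borel_measurable[OF iid] causal_borel_measurable[OF iid causal]
  obtain c where c[measurable]: "\<And>\<tau>. c \<tau> \<in> borel_measurable M"
    and oc: "\<And>\<tau> \<omega>. \<omega> \<in> space M \<Longrightarrow> operational G (\<xi> \<tau> \<omega>) (c \<tau> \<omega>)"
    and fc: "\<And>\<omega>. \<omega> \<in> space M \<Longrightarrow> soc_feasible G (\<lambda>\<tau>. c \<tau> \<omega>)"
    and vc: "long_run_cost M \<xi> c v"
    using v unfolding attainable_costs_def by blast
  define S where "S t \<omega> = soc (s_init G) (\<lambda>t. b t \<omega>) t" for t \<omega>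
  have S_Suc: "S (Suc t) \<omega> = S t \<omega> + b t \<omega>" for t \<omega>
    by (simp add: S_def)
  have [measurable]: "S t \<in> borel_measurable M" for t
    unfolding S_def soc_eq_sum by measurable
  have ob: "operational G (\<xi> t \<omega>) (b t \<omega>)" if "\<omega> \<in> space M" for t \<omega>
    using rt[OF that] by (auto simp: real_time_def is_arg_min_def)
  have box: "b_lo G \<le> b t \<omega> \<and> b t \<omega> \<le> b_hi G" if "\<omega> \<in> space M" for t \<omega>
    using ob[OF that, of t] by (auto simp: operational_def)
  define \<Phi> where "\<Phi> t = expectation (\<lambda>\<omega>. lyapunov w \<gamma> (S t \<omega>))" for t
  define f where "f t = expectation (\<lambda>\<omega>. cost (\<xi> t \<omega>) (b t \<omega>))" for t
  define h where "h \<tau> = expectation (\<lambda>\<omega>. cost (\<xi> \<tau> \<omega>) (c \<tau> \<omega>))" for \<tau>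
  define e where "e \<tau> n = expectation (\<lambda>\<omega>. c \<tau> \<omega> $ n)" for \<tau> n
  obtain C where C: "\<And>d b. data_ok G d \<Longrightarrow> operational G d b \<Longrightarrow> \<bar>cost d b\<bar> \<le> C"
    using cost_bounded[of G] by blast
  have int_c: "integrable M (\<lambda>\<omega>. c \<tau> \<omega> $ n)" for \<tau> n
  proof (rule integrable_boundedI)
    show "\<bar>c \<tau> \<omega> $ n\<bar> \<le> \<bar>b_lo G $ n\<bar> + \<bar>b_hi G $ n\<bar>" if "\<omega> \<in> space M" for \<omega>
      using oc[OF that, of \<tau>] by (auto simp: operational_def less_eq_vec_def dest!: spec[of _ n])
  qed measurable
  \<comment> \<open>The partial sums of the charges are changes of a state that stays within its
    limits, hence bounded by the capacity uniformly in \<open>T\<close>.\<close>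
  have avg_e: "(\<lambda>T. (\<Sum>\<tau><T. e \<tau> n) / real T) \<longlonglongrightarrow> 0" for n
  proof (rule Lim_null_comparison)
    have "\<bar>\<Sum>\<tau><T. e \<tau> n\<bar> \<le> s_hi G $ n - s_lo G $ n" for T
    proof -
      have "\<bar>\<Sum>\<tau><T. c \<tau> \<omega> $ n\<bar> \<le> s_hi G $ n - s_lo G $ n" if "\<omega> \<in> space M" for \<omega>
      proof -
        have "s_lo G $ n \<le> s_init G $ n + (\<Sum>\<tau><T. c \<tau> \<omega> $ n)" "s_init G $ n + (\<Sum>\<tau><T. c \<tau> \<omega> $ n) \<le> s_hi G $ n"
          using fc[OF that] by (auto simp: soc_feasible_def soc_eq_sum less_eq_vec_def)
        moreover have "s_lo G $ n \<le> s_init G $ n" "s_init G $ n \<le> s_hi G $ n"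
          using wp by (auto simp: well_posed_def less_eq_vec_def)
        ultimately show ?thesis by linarith
      qed
      then have "expectation (\<lambda>\<omega>. \<bar>\<Sum>\<tau><T. c \<tau> \<omega> $ n\<bar>) \<le> s_hi G $ n - s_lo G $ n"
        by (intro integral_le_const integrable_abs Bochner_Integration.integrable_sum int_c) auto
      moreover have "\<bar>expectation (\<lambda>\<omega>. \<Sum>\<tau><T. c \<tau> \<omega> $ n)\<bar> \<le> expectation (\<lambda>\<omega>. \<bar>\<Sum>\<tau><T. c \<tau> \<omega> $ n\<bar>)"
        by (rule integral_abs_bound)
      moreover have "(\<Sum>\<tau><T. e \<tau> n) = expectation (\<lambda>\<omega>. \<Sum>\<tau><T. c \<tau> \<omega> $ n)"
        unfolding e_def by (simp add: int_c)
      ultimately show ?thesis by linarith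
    qed
    then show "\<forall>\<^sub>F T in sequentially. norm ((\<Sum>\<tau><T. e \<tau> n) / real T) \<le> (s_hi G $ n - s_lo G $ n) / real T"
      by (auto intro!: always_eventually divide_right_mono)
    show "(\<lambda>T. (s_hi G $ n - s_lo G $ n) / real T) \<longlonglongrightarrow> 0"
      by (rule lim_const_over_n)
  qed
  have step: "\<Phi> (Suc t) + f t \<le> \<Phi> t + (K_bound G w + v)" for t
  proof -
    define x where "x n = w $ n * (expectation (\<lambda>\<omega>. S t \<omega> $ n) + \<gamma> $ n)" for n
    have S_bd: "\<exists>r. \<forall>\<omega>\<in>space M. norm (S u \<omega>) \<le> r" for u
    proof -
      obtain r where "\<And>b. (\<forall>u. b_lo G \<le> b u \<and> b u \<le> b_hi G) \<Longrightarrow> norm (soc (s_init G) b u) \<le> r"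
        using soc_bounded[of G "s_init G" u] by blast
      with box show ?thesis unfolding S_def by (intro exI[of _ r]) simp
    qed
    have int_\<Phi>: "integrable M (\<lambda>\<omega>. lyapunov w \<gamma> (S u \<omega>))" for u
    proof -
      obtain r where r: "\<forall>\<omega>\<in>space M. norm (S u \<omega>) \<le> r" using S_bd by blast
      obtain B where "\<And>s. norm s \<le> r \<Longrightarrow> \<bar>lyapunov w \<gamma> s\<bar> \<le> B" using lyapunov_bounded by blast
      with r show ?thesis by (intro integrable_boundedI[where B = B]) auto
    qed
    have int_f: "integrable M (\<lambda>\<omega>. cost (\<xi> t \<omega>) (b t \<omega>))"
      by (intro integrable_boundedI[where B = C] C d ob) simp_all
    have int_o: "integrable M (\<lambda>\<omega>. real_time_objective w \<gamma> (S t \<omega>) (\<xi> t \<omega>) (b t \<omega>))"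
    proof -
      obtain r where r: "\<forall>\<omega>\<in>space M. norm (S t \<omega>) \<le> r" using S_bd by blast
      obtain B where "\<And>s d b. norm s \<le> r \<Longrightarrow> data_ok G d \<Longrightarrow> operational G d b
          \<Longrightarrow> \<bar>real_time_objective w \<gamma> s d b\<bar> \<le> B"
        using real_time_objective_bounded[of r G w \<gamma>] by blast
      with r d ob show ?thesis by (intro integrable_boundedI[where B = B]) auto
    qed
    have "expectation (\<lambda>\<omega>. lyapunov w \<gamma> (S (Suc t) \<omega>) + cost (\<xi> t \<omega>) (b t \<omega>))
        \<le> expectation (\<lambda>\<omega>. lyapunov w \<gamma> (S t \<omega>) + K_bound G w
            + real_time_objective w \<gamma> (S t \<omega>) (\<xi> t \<omega>) (b t \<omega>))"
    proof (rule integral_mono)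
      show "lyapunov w \<gamma> (S (Suc t) \<omega>) + cost (\<xi> t \<omega>) (b t \<omega>) \<le> lyapunov w \<gamma> (S t \<omega>) + K_bound G w
          + real_time_objective w \<gamma> (S t \<omega>) (\<xi> t \<omega>) (b t \<omega>)" if "\<omega> \<in> space M" for \<omega>
        unfolding S_Suc using box[OF that] w by (intro lyapunov_drift) auto
    qed (use int_\<Phi> int_f int_o in simp_all)
    then have drift: "\<Phi> (Suc t) + f t \<le> \<Phi> t + K_bound G w
        + expectation (\<lambda>\<omega>. real_time_objective w \<gamma> (S t \<omega>) (\<xi> t \<omega>) (b t \<omega>))"
      using int_\<Phi> int_f int_o by (simp add: \<Phi>_def f_def prob_space)
    \<comment> \<open>The left side is independent of \<open>\<tau>\<close>, so averaging the right
      side over \<open>\<tau>\<close> preserves the inequality.\<close>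
    have le: "\<Phi> (Suc t) + f t - \<Phi> t - K_bound G w \<le> (\<Sum>n\<in>UNIV. x n * e \<tau> n) + h \<tau>" for \<tau>
      using drift real_time_objective_le_competitor[OF wp d a2 rt iid causal c oc, of t \<tau>]
      unfolding x_def e_def h_def S_def by simp
    have "(\<lambda>T. (\<Sum>n\<in>UNIV. x n * ((\<Sum>\<tau><T. e \<tau> n) / real T)) + (\<Sum>\<tau><T. h \<tau>) / real T)
        \<longlonglongrightarrow> (\<Sum>n\<in>UNIV. x n * 0) + v"
      using vc unfolding long_run_cost_def h_def[symmetric]
      by (intro tendsto_add tendsto_sum tendsto_mult tendsto_const avg_e)
    moreover have "\<Phi> (Suc t) + f t - \<Phi> t - K_bound G w
        \<le> (\<Sum>n\<in>UNIV. x n * ((\<Sum>\<tau><T. e \<tau> n) / real T)) + (\<Sum>\<tau><T. h \<tau>) / real T" if "0 < T" for T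
    proof -
      have "real T * (\<Phi> (Suc t) + f t - \<Phi> t - K_bound G w) \<le> (\<Sum>\<tau><T. (\<Sum>n\<in>UNIV. x n * e \<tau> n) + h \<tau>)"
        using sum_mono[OF le, of "{..<T}"] by simp
      also have "\<dots> = (\<Sum>n\<in>UNIV. x n * (\<Sum>\<tau><T. e \<tau> n)) + (\<Sum>\<tau><T. h \<tau>)"
        by (simp add: sum.distrib sum_distrib_left sum.swap[of _ "{..<T}"])
      finally have "\<Phi> (Suc t) + f t - \<Phi> t - K_bound G w
          \<le> ((\<Sum>n\<in>UNIV. x n * (\<Sum>\<tau><T. e \<tau> n)) + (\<Sum>\<tau><T. h \<tau>)) / real T"
        using that by (simp add: pos_le_divide_eq mult.commute)
      also have "\<dots> = (\<Sum>n\<in>UNIV. x n * (\<Sum>\<tau><T. e \<tau> n)) / real T + (\<Sum>\<tau><T. h \<tau>) / real T"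
        by (rule add_divide_distrib)
      also have "(\<Sum>n\<in>UNIV. x n * (\<Sum>\<tau><T. e \<tau> n)) / real T = (\<Sum>n\<in>UNIV. x n * ((\<Sum>\<tau><T. e \<tau> n) / real T))"
        by (subst sum_divide_distrib) simp
      finally show ?thesis .
    qed
    ultimately have "\<Phi> (Suc t) + f t - \<Phi> t - K_bound G w \<le> (\<Sum>n\<in>UNIV. x n * 0) + v"
      by (intro LIMSEQ_le_const) (auto intro!: exI[of _ 1])
    then show ?thesis by simp
  qed
  \<comment> \<open>Nonnegativity allows the final term \<open>\<Phi> T\<close> of the telescoped
    sum to be dropped; the initial one vanishes after division by \<open>T\<close>.\<close>
  have "0 \<le> \<Phi> T" for T
    unfolding \<Phi>_def by (intro Bochner_Integration.integral_nonneg lyapunov_nonneg w)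
  moreover have "\<Phi> T + (\<Sum>t<T. f t) \<le> \<Phi> 0 + real T * (K_bound G w + v)" for T
  proof (induction T)
    case (Suc T)
    then show ?case using step[of T] by (simp add: algebra_simps)
  qed simp
  ultimately have sum_f: "(\<Sum>t<T. f t) \<le> \<Phi> 0 + real T * (K_bound G w + v)" for T
    by (smt (verit))
  have "(\<lambda>T. (\<Sum>t<T. f t) / real T) \<longlonglongrightarrow> L"
    using L by (simp add: long_run_cost_def f_def)
  moreover have "(\<lambda>T. \<Phi> 0 / real T + (K_bound G w + v)) \<longlonglongrightarrow> 0 + (K_bound G w + v)"
    by (intro tendsto_add lim_const_over_n tendsto_const)
  moreover have "(\<Sum>t<T. f t) / real T \<le> \<Phi> 0 / real T + (K_bound G w + v)" if "1 \<le> T" for T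
    using sum_f[of T] that by (simp add: field_simps)
  ultimately show ?thesis
    using LIMSEQ_le by fastforce
qed

text \<open>Positivity of \<open>\<gamma>_star\<close> appears as a criterion because it can fail,
  for instance when \<open>b_lo\<close>, \<open>b_hi\<close> and \<open>s_lo\<close> vanish at
  \<open>n\<close> and \<open>g_hi G n\<close> is positive. Comparing with every attainable cost
  covers the minimum without presupposing that it exists.\<close>

theorem corollary1:
  fixes G :: "('n::finite) grid_params"
    and M :: "'w measure"
    and \<xi> :: "nat \<Rightarrow> 'w \<Rightarrow> 'n datum"
  assumes "prob_space M"
    and "well_posed G"
    and "\<forall>t. \<forall>\<omega>\<in>space M. data_ok G (\<xi> t \<omega>)"
    and a1: "\<forall>n. s_hi G $ n - s_lo G $ n > b_hi G $ n - b_lo G $ n"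
    and a2: "\<forall>t. \<forall>\<omega>\<in>space M. voltage_ok G (\<xi> t \<omega>) (load (\<xi> t \<omega>))"
    and "\<forall>n. 0 < \<delta> G n"
  shows
    "is_arg_min (\<lambda>(w, \<gamma>). K_bound G w) (\<lambda>(w, \<gamma>). params_ok G w \<gamma>) (w_star G, \<gamma>_star G)
     \<and> (\<forall>w \<gamma>. is_arg_min (\<lambda>(w, \<gamma>). K_bound G w) (\<lambda>(w, \<gamma>). params_ok G w \<gamma>) (w, \<gamma>) \<longrightarrow>
          (\<forall>n. b_lo G $ n \<noteq> 0 \<or> b_hi G $ n \<noteq> 0 \<longrightarrow>
             w $ n = w_star G $ n \<and> \<gamma> $ n = \<gamma>_star G $ n))
     \<and> K_bound G (w_star G) = (\<Sum>n\<in>UNIV. max ((b_hi G $ n)\<^sup>2) ((b_lo G $ n)\<^sup>2) / (2 * \<delta> G n))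
     \<and> (\<forall>n. 0 < \<gamma>_star G $ n \<longleftrightarrow>
          g_hi G n * (s_hi G $ n - b_hi G $ n) < g_lo G n * (s_lo G $ n - b_lo G $ n))
     \<and> (\<forall>w \<gamma> b. params_ok G w \<gamma> \<and>
            (\<forall>\<omega>\<in>space M. real_time G w \<gamma> (\<lambda>t. \<xi> t \<omega>) (\<lambda>t. b t \<omega>)) \<longrightarrow>
          ((\<forall>t. \<forall>\<omega>\<in>space M. marginal_cost_within G (\<xi> t \<omega>)) \<longrightarrow>
             (\<forall>\<omega>\<in>space M. soc_feasible G (\<lambda>t. b t \<omega>)))
          \<and> (iid M \<xi> \<and> causal M \<xi> b \<longrightarrow>
               (\<forall>L v. long_run_cost M \<xi> b L \<and> v \<in> attainable_costs G M \<xi> \<longrightarrow>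
                  L - v \<le> K_bound G w)))"
proof -
  interpret prob_space M by fact
  have h: "\<forall>n. g_lo G n < g_hi G n"
    using a1 assms(6) g_lo_less_g_hi by metis
  have ok: "params_ok G (w_star G) (\<gamma>_star G)"
    using params_ok_star h assms(6) by blast
  have le: "w_star G $ n \<le> w $ n" if "params_ok G w \<gamma>" for w \<gamma> n
    using w_star_le[OF that] assms(6) by blast
  have "is_arg_min (\<lambda>(w, \<gamma>). K_bound G w) (\<lambda>(w, \<gamma>). params_ok G w \<gamma>) (w_star G, \<gamma>_star G)"
    using ok K_bound_mono[OF le] by (auto simp: is_arg_min_def not_less)
  moreover have "w $ n = w_star G $ n \<and> \<gamma> $ n = \<gamma>_star G $ n"
    if min: "is_arg_min (\<lambda>(w, \<gamma>). K_bound G w) (\<lambda>(w, \<gamma>). params_ok G w \<gamma>) (w, \<gamma>)"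
      and n: "b_lo G $ n \<noteq> 0 \<or> b_hi G $ n \<noteq> 0" for w \<gamma> n
  proof -
    have p: "params_ok G w \<gamma>" and K: "\<not> K_bound G (w_star G) < K_bound G w"
      using min ok by (auto simp: is_arg_min_def)
    \<comment> \<open>All weights are at least the starred ones, so a strict excess at
      \<open>n\<close> would contradict minimality.\<close>
    have "\<not> w_star G $ n < w $ n"
      using K K_bound_strict_mono[OF le[OF p] _ n] by blast
    then have "w $ n = w_star G $ n"
      using le[OF p, of n] by simp
    then show ?thesis
      using \<gamma>_unique_if_w_star[OF h[rule_format] p] by blast
  qed
  moreover have "0 < \<gamma>_star G $ n \<longleftrightarrow>
      g_hi G n * (s_hi G $ n - b_hi G $ n) < g_lo G n * (s_lo G $ n - b_lo G $ n)" for n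
    using h[rule_format, of n] by (simp add: \<gamma>_star_def divide_less_0_iff)
  moreover have "soc_feasible G (\<lambda>t. b t \<omega>)"
    if "params_ok G w \<gamma>" "\<forall>\<omega>\<in>space M. real_time G w \<gamma> (\<lambda>t. \<xi> t \<omega>) (\<lambda>t. b t \<omega>)"
      "\<forall>t. \<forall>\<omega>\<in>space M. marginal_cost_within G (\<xi> t \<omega>)" "\<omega> \<in> space M" for w \<gamma> b \<omega>
    using that assms(2,3) a2 by (intro real_time_soc_feasible[of G w \<gamma> "\<lambda>t. \<xi> t \<omega>"]) auto
  moreover have "L - v \<le> K_bound G w"
    if p: "params_ok G w \<gamma>" and rt: "\<forall>\<omega>\<in>space M. real_time G w \<gamma> (\<lambda>t. \<xi> t \<omega>) (\<lambda>t. b t \<omega>)"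
      and iid: "iid M \<xi>" and causal: "causal M \<xi> b"
      and L: "long_run_cost M \<xi> b L" and v: "v \<in> attainable_costs G M \<xi>" for w \<gamma> b L v
  proof -
    have "0 \<le> w $ n" for n
      using p by (auto simp: params_ok_def less_imp_le)
    then have "L \<le> K_bound G w + v"
      using assms(3) a2 rt by (intro real_time_long_run_cost_le[OF assms(2) _ _ _ _ iid causal L v]) auto
    then show ?thesis by simp
  qed
  ultimately show ?thesis
    using K_bound_star[of G] by blast
qed

end
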